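(* Let $\{\sigma_n\}_{n\in\mathbb{N}}$ be a sequence of real numbers and let $\mathcal{X}=\{x\in\mathbb{R}^{\mathbb{N}} : x_n\in\{\sigma_n,-\sigma_n\}\text{ for all }n\}$ (the Rademacher space). Then $\mathcal{X}$ admits detection if and only if $\sum_n \sigma_n^4=\infty$.
   Context: Noise: $\xi=(\xi_n)_{n\in\mathbb{N}}$ is a sequence of independent standard real Gaussian random variables. A set $\mathcal{X}\subset\mathbb{R}^{\mathbb{N}}$ admits detection if there is a Borel measurable map $T:\mathbb{R}^{\mathbb{N}}\to\{0,1\}$ (product topology on $\mathbb{R}^{\mathbb{N}}$) such that $T(\xi)=0$ almost surely and, for every $x\in\mathcal{X}$, $T(x+\xi)=1$ almost surely. *)

theory Defs
  imports "HOL-Probability.Probability"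
begin

definition gaussian_noise :: "'a measure \<Rightarrow> (nat \<Rightarrow> 'a \<Rightarrow> real) \<Rightarrow> bool" where
  "gaussian_noise M \<xi> \<longleftrightarrow>
     prob_space M \<and>
     prob_space.indep_vars M (\<lambda>_. borel) \<xi> UNIV \<and>
     (\<forall>n. distributed M lborel (\<xi> n) (\<lambda>x. ennreal (std_normal_density x)))"

text \<open>
  The type \<^typ>\<open>nat \<Rightarrow> real\<close> carries the product topology (HOL-Analysis.Function_Topology), so
  \<^term>\<open>borel :: (nat \<Rightarrow> real) measure\<close> is its Borel sigma-algebra.
\<close>

definition admits_detection ::
    "'a measure \<Rightarrow> (nat \<Rightarrow> 'a \<Rightarrow> real) \<Rightarrow> (nat \<Rightarrow> real) set \<Rightarrow> bool" where
  "admits_detection M \<xi> X \<longleftrightarrow>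
     (\<exists>T :: (nat \<Rightarrow> real) \<Rightarrow> nat.
        T \<in> borel \<rightarrow>\<^sub>M count_space {0, 1} \<and>
        (AE \<omega> in M. T (\<lambda>n. \<xi> n \<omega>) = 0) \<and>
        (\<forall>x\<in>X. AE \<omega> in M. T (\<lambda>n. x n + \<xi> n \<omega>) = 1))"

definition rademacher_space :: "(nat \<Rightarrow> real) \<Rightarrow> (nat \<Rightarrow> real) set" where
  "rademacher_space \<sigma> = {x. \<forall>n. x n \<in> {\<sigma> n, - \<sigma> n}}"

end

theory Submission
  imports Defs
begin

text \<open>
  If the series diverges, put $a_n = \min(\sigma_n^2, 1)$ and $A_N = \sum_{n<N} a_n^2$, so that still
  $A_N \to \infty$. The statistic $\sum_{n<N} a_n (y_n^2 - 1)$ has mean $0$ and variance $2 A_N$ under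
  pure noise, and mean $m \ge A_N$ and variance at most $6m$ in the presence of a signal. Chebyshev's
  inequality along a subsequence with $A_{N_k} \ge 2^k$ and the Borel--Cantelli lemma show that comparing
  it with $A_{N_k}/2$ for large $k$ decides correctly almost surely.

  If the series converges, let $L_N$ be the likelihood ratio of the noise shifted by uniformly random
  signs in the first $N$ coordinates. Its second moment is $\prod_{n<N} \cosh(\sigma_n^2)$, which stays
  bounded. A null set of the noise is contained in an open set $U$ of small noise measure, hence for
  every $N$ some choice of the first $N$ signs, followed by zeros, shifts the noise into $U$ with
  probability at most $1/2$. By compactness and Fatou's lemma ($U$ is open) the same holds for some
  signal in the whole space.
\<close>

subsection \<open>White noise and the Cameron--Martin formula\<close>

definition std_gaussian :: "real measure" where
  "std_gaussian = density lborel std_normal_density"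

text \<open>The law of the noise, realised on sequence space itself: there the topology is available
  for outer regularity, Fatou and compactness.\<close>

definition gaussian_seq :: "(nat \<Rightarrow> real) measure" where
  "gaussian_seq = Pi\<^sub>M UNIV (\<lambda>_. std_gaussian)"

lemma sets_std_gaussian [measurable_cong, simp]: "sets std_gaussian = sets borel"
  by (simp add: std_gaussian_def)

lemma space_std_gaussian [simp]: "space std_gaussian = UNIV"
  by (simp add: std_gaussian_def)

lemma prob_space_std_gaussian: "prob_space std_gaussian"
  unfolding std_gaussian_def by (rule prob_space_normal_density) simp

text \<open>On a countable product of real lines the product sigma-algebra coincides with the Borel
  sigma-algebra of the product topology.\<close>

lemma sets_gaussian_seq [measurable_cong, simp]: "sets gaussian_seq = sets borel"
proof -
  have "sets gaussian_seq = sets (Pi\<^sub>M UNIV (\<lambda>_::nat. borel :: real measure))"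
    unfolding gaussian_seq_def by (rule sets_PiM_cong) auto
  then show ?thesis using sets_PiM_equal_borel by metis
qed

lemma space_gaussian_seq [simp]: "space gaussian_seq = UNIV"
  using sets_eq_imp_space_eq[OF sets_gaussian_seq] by simp

lemma prob_space_gaussian_seq: "prob_space gaussian_seq"
  unfolding gaussian_seq_def by (intro prob_space_PiM prob_space_std_gaussian)

lemma borel_measurable_coordinate [measurable]: "(\<lambda>y::nat \<Rightarrow> real. y n) \<in> borel_measurable borel"
  by (intro borel_measurable_continuous_onI continuous_on_product_coordinates)

lemma borel_measurable_seqI:
  fixes f :: "'a \<Rightarrow> nat \<Rightarrow> real"
  assumes "\<And>n. (\<lambda>x. f x n) \<in> borel_measurable M"
  shows "f \<in> borel_measurable M"
proof -
  have "f \<in> measurable M (Pi\<^sub>M UNIV (\<lambda>_::nat. borel :: real measure))"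
    using assms by (intro measurable_PiM_single') auto
  then show ?thesis
    using measurable_cong_sets[OF refl sets_PiM_equal_borel] by blast
qed

lemma borel_measurable_seq_add:
  fixes z :: "nat \<Rightarrow> real"
  shows "(\<lambda>y n. z n + y n) \<in> borel_measurable borel"
  by (rule borel_measurable_seqI) auto

text \<open>After a translation in the Lebesgue integral, the factor
  \<open>exp (a * t - a\<^sup>2 / 2)\<close> is the ratio of the normal densities at
  \<open>t - a\<close> and at \<open>t\<close>.\<close>

lemma nn_integral_std_gaussian_shift:
  fixes f :: "real \<Rightarrow> ennreal"
  assumes [measurable]: "f \<in> borel_measurable borel"
  shows "(\<integral>\<^sup>+t. f (t + a) \<partial>std_gaussian) = (\<integral>\<^sup>+t. f t * ennreal (exp (a * t - a\<^sup>2 / 2)) \<partial>std_gaussian)"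
proof -
  have "(\<integral>\<^sup>+t. f (t + a) \<partial>std_gaussian) = (\<integral>\<^sup>+t. ennreal (std_normal_density t) * f (t + a) \<partial>lborel)"
    unfolding std_gaussian_def by (subst nn_integral_density) auto
  also have "\<dots> = (\<integral>\<^sup>+t. ennreal (std_normal_density (t - a)) * f t \<partial>lborel)"
    using nn_integral_real_affine[of "\<lambda>t. ennreal (std_normal_density (t - a)) * f t" 1 a]
    by (simp add: add.commute)
  also have "\<dots> = (\<integral>\<^sup>+t. ennreal (std_normal_density t) * (f t * ennreal (exp (a * t - a\<^sup>2 / 2))) \<partial>lborel)"
  proof (rule nn_integral_cong)
    fix t :: real
    have "std_normal_density (t - a) = std_normal_density t * exp (a * t - a\<^sup>2 / 2)"
      by (simp add: std_normal_density_def exp_add[symmetric] power2_eq_square field_simps)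
    then show "ennreal (std_normal_density (t - a)) * f t =
        ennreal (std_normal_density t) * (f t * ennreal (exp (a * t - a\<^sup>2 / 2)))"
      by (simp add: ennreal_mult mult_ac)
  qed
  also have "\<dots> = (\<integral>\<^sup>+t. f t * ennreal (exp (a * t - a\<^sup>2 / 2)) \<partial>std_gaussian)"
    unfolding std_gaussian_def by (subst nn_integral_density) auto
  finally show ?thesis .
qed

text \<open>Tonelli separates coordinate \<open>n\<close> from the others, and the one-dimensional
  formula applies to the inner integral. Moving one coordinate at a time is the form in which signs
  are chosen later.\<close>

lemma nn_integral_gaussian_seq_shift:
  fixes f :: "(nat \<Rightarrow> real) \<Rightarrow> ennreal"
  assumes f [measurable]: "f \<in> borel_measurable borel"
  shows "(\<integral>\<^sup>+y. f (y(n := y n + a)) \<partial>gaussian_seq) =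
    (\<integral>\<^sup>+y. f y * ennreal (exp (a * y n - a\<^sup>2 / 2)) \<partial>gaussian_seq)"
proof -
  let ?P = "Pi\<^sub>M (UNIV - {n}) (\<lambda>_. std_gaussian)"
  interpret P: prob_space ?P by (intro prob_space_PiM prob_space_std_gaussian)
  interpret S: prob_space std_gaussian by (rule prob_space_std_gaussian)
  interpret SP: pair_sigma_finite std_gaussian ?P ..
  \<comment> \<open>Inserting an independent Gaussian at place \<open>n\<close> into the product
    over the remaining indices recovers the full product.\<close>
  have eq: "gaussian_seq = distr (std_gaussian \<Otimes>\<^sub>M ?P) gaussian_seq (\<lambda>(t, X). X(n := t))"
    using distr_pair_PiM_eq_PiM[of "UNIV - {n}" "\<lambda>_. std_gaussian" n] prob_space_std_gaussian
    by (simp add: gaussian_seq_def insert_absorb)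
  have "(\<lambda>p. (snd p)(n := fst p)) \<in> borel_measurable (std_gaussian \<Otimes>\<^sub>M ?P)"
  proof (rule borel_measurable_seqI)
    fix k show "(\<lambda>p. ((snd p)(n := fst p)) k) \<in> borel_measurable (std_gaussian \<Otimes>\<^sub>M ?P)"
      by (cases "k = n") auto
  qed
  then have [measurable]: "(\<lambda>(t, X). X(n := t)) \<in> measurable (std_gaussian \<Otimes>\<^sub>M ?P) borel"
    "(\<lambda>(t, X). X(n := t)) \<in> measurable (std_gaussian \<Otimes>\<^sub>M ?P) gaussian_seq"
    by (simp_all add: case_prod_unfold measurable_cong_sets[OF refl sets_gaussian_seq])
  have upd [measurable]: "(\<lambda>y::nat\<Rightarrow>real. y(n := y n + a)) \<in> borel_measurable borel"
  proof (rule borel_measurable_seqI)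
    fix k show "(\<lambda>y::nat\<Rightarrow>real. (y(n := y n + a)) k) \<in> borel_measurable borel"
      by (cases "k = n") auto
  qed
  have split: "(\<integral>\<^sup>+y. g y \<partial>gaussian_seq) = (\<integral>\<^sup>+X. \<integral>\<^sup>+t. g (X(n := t)) \<partial>std_gaussian \<partial>?P)"
    if [measurable]: "g \<in> borel_measurable borel" for g
  proof -
    have "(\<integral>\<^sup>+y. g y \<partial>gaussian_seq) = (\<integral>\<^sup>+p. g (case p of (t, X) \<Rightarrow> X(n := t)) \<partial>(std_gaussian \<Otimes>\<^sub>M ?P))"
      by (subst eq, subst nn_integral_distr) auto
    also have "\<dots> = (\<integral>\<^sup>+X. \<integral>\<^sup>+t. g (X(n := t)) \<partial>std_gaussian \<partial>?P)"
      by (subst SP.nn_integral_snd[symmetric]) auto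
    finally show ?thesis .
  qed
  have "(\<integral>\<^sup>+y. f (y(n := y n + a)) \<partial>gaussian_seq) = (\<integral>\<^sup>+X. \<integral>\<^sup>+t. f (X(n := t + a)) \<partial>std_gaussian \<partial>?P)"
    by (subst split) auto
  also have "\<dots> = (\<integral>\<^sup>+X. \<integral>\<^sup>+t. f (X(n := t)) * ennreal (exp (a * t - a\<^sup>2 / 2)) \<partial>std_gaussian \<partial>?P)"
  proof (rule nn_integral_cong, rule nn_integral_std_gaussian_shift[where f = "\<lambda>t. f (X(n := t))" for X])
    fix X
    have "(\<lambda>t::real. X(n := t)) \<in> borel_measurable borel"
    proof (rule borel_measurable_seqI)
      fix k show "(\<lambda>t. (X(n := t)) k) \<in> borel_measurable borel" by (cases "k = n") auto
    qed
    then show "(\<lambda>t. f (X(n := t))) \<in> borel_measurable borel" by simp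
  qed
  also have "\<dots> = (\<integral>\<^sup>+y. f y * ennreal (exp (a * y n - a\<^sup>2 / 2)) \<partial>gaussian_seq)"
    by (subst split) auto
  finally show ?thesis .
qed

subsection \<open>No detection when the fourth powers are summable\<close>

text \<open>The likelihood ratio of the mixture of $N(s,1)$ and $N(-s,1)$ with equal weights against $N(0,1)$.\<close>

definition sign_lr :: "real \<Rightarrow> real \<Rightarrow> real" where
  "sign_lr s t = cosh (s * t) * exp (- s\<^sup>2 / 2)"

lemma sign_lr_nonneg: "0 \<le> sign_lr s t"
  by (simp add: sign_lr_def cosh_real_nonneg)

lemma sign_lr_measurable [measurable]: "sign_lr s \<in> borel_measurable borel"
  unfolding sign_lr_def cosh_field_def by measurable

text \<open>The two summands are the Cameron-Martin densities of the shifts by \<open>s\<close> and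
  \<open>- s\<close>; \<open>sign_lr\<close> is their average.\<close>

lemma sign_lr_eq: "2 * sign_lr s t = exp (s * t - s\<^sup>2 / 2) + exp (- s * t - (- s)\<^sup>2 / 2)"
proof -
  have "exp (s * t - s\<^sup>2 / 2) = exp (s * t) * exp (- s\<^sup>2 / 2)"
    "exp (- s * t - (- s)\<^sup>2 / 2) = exp (- (s * t)) * exp (- s\<^sup>2 / 2)"
    by (simp_all add: exp_add[symmetric])
  then show ?thesis by (simp add: sign_lr_def cosh_field_def algebra_simps)
qed

section \<open>Choosing signs by averaging\<close>

text \<open>The right-hand side is the mean of the two shifted integrals, and two numbers cannot
  both exceed their mean.\<close>

lemma exists_sign_shift_le:
  fixes f :: "(nat \<Rightarrow> real) \<Rightarrow> ennreal"
  assumes [measurable]: "f \<in> borel_measurable borel"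
  shows "\<exists>a\<in>{s, - s}. (\<integral>\<^sup>+y. f (y(n := y n + a)) \<partial>gaussian_seq) \<le>
    (\<integral>\<^sup>+y. f y * ennreal (sign_lr s (y n)) \<partial>gaussian_seq)"
proof (rule ccontr)
  let ?I = "\<lambda>a. \<integral>\<^sup>+y. f (y(n := y n + a)) \<partial>gaussian_seq"
  let ?J = "\<integral>\<^sup>+y. f y * ennreal (sign_lr s (y n)) \<partial>gaussian_seq"
  assume "\<not> ?thesis"
  then have less: "?J < ?I s" "?J < ?I (- s)" by auto
  have "?I s + ?I (- s) =
      (\<integral>\<^sup>+y. f y * ennreal (exp (s * y n - s\<^sup>2 / 2)) + f y * ennreal (exp (- s * y n - (- s)\<^sup>2 / 2)) \<partial>gaussian_seq)"
    by (simp only: nn_integral_gaussian_seq_shift[OF assms]) (subst nn_integral_add; simp)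
  also have "\<dots> = (\<integral>\<^sup>+y. 2 * (f y * ennreal (sign_lr s (y n))) \<partial>gaussian_seq)"
  proof (rule nn_integral_cong)
    fix y :: "nat \<Rightarrow> real"
    have "ennreal (exp (s * y n - s\<^sup>2 / 2)) + ennreal (exp (- s * y n - (- s)\<^sup>2 / 2)) = 2 * ennreal (sign_lr s (y n))"
      by (subst ennreal_plus[symmetric]) (simp_all only: sign_lr_eq[symmetric], simp_all add: ennreal_mult')
    then show "f y * ennreal (exp (s * y n - s\<^sup>2 / 2)) + f y * ennreal (exp (- s * y n - (- s)\<^sup>2 / 2)) =
        2 * (f y * ennreal (sign_lr s (y n)))"
      by (metis distrib_left mult.left_commute)
  qed
  also have "\<dots> = ?J + ?J"
    by (subst nn_integral_cmult) (auto simp: mult_2)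
  finally show False
    using add_strict_mono[OF less] by simp
qed

text \<open>The random signs are replaced by fixed ones coordinate by coordinate. The induction
  keeps \<open>f\<close> arbitrary because each step changes the integrand.\<close>

lemma exists_signs_truncated_shift_le:
  fixes f :: "(nat \<Rightarrow> real) \<Rightarrow> ennreal"
  assumes "f \<in> borel_measurable borel"
  shows "\<exists>x\<in>rademacher_space \<sigma>.
    (\<integral>\<^sup>+y. f (\<lambda>n. (if n < N then x n else 0) + y n) \<partial>gaussian_seq) \<le>
    (\<integral>\<^sup>+y. f y * (\<Prod>n<N. ennreal (sign_lr (\<sigma> n) (y n))) \<partial>gaussian_seq)"
  using assms
proof (induction N arbitrary: f)
  case 0
  have "\<sigma> \<in> rademacher_space \<sigma>" by (simp add: rademacher_space_def)
  then show ?case by auto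
next
  case (Suc N)
  note [measurable] = Suc.prems
  let ?tr = "\<lambda>x n. if n < N then x n else (0::real)"
  \<comment> \<open>The weight of coordinate \<open>N\<close> is absorbed into the test function.
    The shift truncated at \<open>N\<close> vanishes there, so the weight still sees the unshifted
    \<open>y N\<close>.\<close>
  from Suc.IH[of "\<lambda>y. f y * ennreal (sign_lr (\<sigma> N) (y N))"]
  obtain x where x: "x \<in> rademacher_space \<sigma>"
    and le: "(\<integral>\<^sup>+y. f (\<lambda>n. ?tr x n + y n) * ennreal (sign_lr (\<sigma> N) (y N)) \<partial>gaussian_seq) \<le>
      (\<integral>\<^sup>+y. f y * ennreal (sign_lr (\<sigma> N) (y N)) * (\<Prod>n<N. ennreal (sign_lr (\<sigma> n) (y n))) \<partial>gaussian_seq)"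
    by auto
  note borel_measurable_seq_add [measurable]
  obtain a where a: "a \<in> {\<sigma> N, - \<sigma> N}" and
    le2: "(\<integral>\<^sup>+y. f (\<lambda>n. ?tr x n + (y(N := y N + a)) n) \<partial>gaussian_seq) \<le>
    (\<integral>\<^sup>+y. f (\<lambda>n. ?tr x n + y n) * ennreal (sign_lr (\<sigma> N) (y N)) \<partial>gaussian_seq)"
    using exists_sign_shift_le[of "\<lambda>y. f (\<lambda>n. ?tr x n + y n)" "\<sigma> N" N] by auto
  \<comment> \<open>Overwriting \<open>x N\<close> is harmless: the truncation at \<open>N\<close>
    has hidden this entry so far.\<close>
  have "x(N := a) \<in> rademacher_space \<sigma>"
    using x a by (auto simp: rademacher_space_def)
  moreover have "(\<lambda>n. (if n < Suc N then (x(N := a)) n else 0) + y n) = (\<lambda>n. ?tr x n + (y(N := y N + a)) n)" for y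
    by (auto simp: fun_eq_iff)
  ultimately show ?case
    using order_trans[OF le2 le] by (intro bexI[of _ "x(N := a)"]) (simp_all add: mult_ac)
qed

section \<open>Second moment of the likelihood ratio\<close>

text \<open>Applied with x = \<open>(\<sigma> n)\<^sup>2\<close>, this turns a product of
  \<open>cosh\<close> factors into the exponential of a sum of fourth powers. Quadratic bounds on
  the exponentials settle \<open>x \<le> 1\<close>; beyond 1 the bound
  \<open>cosh x \<le> exp x\<close> is enough.\<close>

lemma cosh_le_exp_square:
  fixes x :: real
  assumes "0 \<le> x"
  shows "cosh x \<le> exp (x\<^sup>2)"
proof (cases "x \<le> 1")
  case True
  \<comment> \<open>The product equals 1 + x^3. Replacing \<open>1 + x\<close> by
    \<open>exp x\<close> then bounds \<open>exp (- x)\<close> from above.\<close>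
  have "1 \<le> (1 - x + x\<^sup>2) * (1 + x)"
    using assms by (simp add: algebra_simps power2_eq_square)
  also have "\<dots> \<le> (1 - x + x\<^sup>2) * exp x"
    using True by (intro mult_left_mono) (auto simp: exp_ge_add_one_self)
  finally have "exp (- x) \<le> 1 - x + x\<^sup>2"
    by (simp add: exp_minus field_simps)
  moreover have "exp x \<le> 1 + x + x\<^sup>2"
    using exp_bound[of x] assms True by simp
  ultimately have "cosh x \<le> 1 + x\<^sup>2"
    by (simp add: cosh_field_def)
  also have "\<dots> \<le> exp (x\<^sup>2)" by (rule exp_ge_add_one_self)
  finally show ?thesis .
next
  case False
  have "exp (- x) \<le> exp x" using assms by simp
  then have "cosh x \<le> exp x" by (simp add: cosh_field_def)
  also have "\<dots> \<le> exp (x\<^sup>2)" using False by (simp add: power2_eq_square)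
  finally show ?thesis .
qed

text \<open>The shift formula for the constant function 1 says that the Cameron-Martin density has
  total mass 1; multiplying by \<open>exp (a\<^sup>2 / 2)\<close> gives the moment generating
  function.\<close>

lemma nn_integral_std_gaussian_exp:
  "(\<integral>\<^sup>+t. ennreal (exp (a * t)) \<partial>std_gaussian) = ennreal (exp (a\<^sup>2 / 2))"
proof -
  interpret prob_space std_gaussian by (rule prob_space_std_gaussian)
  have meas: "(\<lambda>t. ennreal (exp (a * t - a\<^sup>2 / 2))) \<in> borel_measurable std_gaussian"
    by (subst measurable_cong_sets[OF sets_std_gaussian refl])
      (intro measurable_compose[OF _ measurable_ennreal] borel_measurable_continuous_onI continuous_intros)
  have "1 = (\<integral>\<^sup>+t. ennreal (exp (a * t - a\<^sup>2 / 2)) \<partial>std_gaussian)"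
    using nn_integral_std_gaussian_shift[of "\<lambda>_. 1" a] emeasure_space_1 by simp
  then have "ennreal (exp (a\<^sup>2 / 2)) = ennreal (exp (a\<^sup>2 / 2)) * (\<integral>\<^sup>+t. ennreal (exp (a * t - a\<^sup>2 / 2)) \<partial>std_gaussian)"
    by simp
  also have "\<dots> = (\<integral>\<^sup>+t. ennreal (exp (a * t)) \<partial>std_gaussian)"
    by (subst nn_integral_cmult[symmetric]) (auto simp: meas ennreal_mult[symmetric] exp_add[symmetric])
  finally show ?thesis by simp
qed

text \<open>The square expands into exponentials with rates \<open>2 * s\<close>,
  \<open>- 2 * s\<close> and a constant, whose means are known. The result is 1 + s^4/2 to leading
  order, which is where the fourth powers originate.\<close>

lemma nn_integral_sign_lr_square:
  "(\<integral>\<^sup>+t. ennreal ((sign_lr s t)\<^sup>2) \<partial>std_gaussian) = ennreal (cosh (s\<^sup>2))"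
proof -
  interpret prob_space std_gaussian by (rule prob_space_std_gaussian)
  let ?c = "exp (- s\<^sup>2) / 4"
  \<comment> \<open>\<open>ennreal\<close> distributes over sums and products of nonnegative terms;
    the bracketing matches the expanded square below.\<close>
  have split: "ennreal (c * (p + (q + 2))) = ennreal c * (ennreal p + (ennreal q + ennreal 2))"
    if "0 \<le> c" "0 \<le> p" "0 \<le> q" for c p q
    using that by (simp only: ennreal_mult ennreal_plus add_nonneg_nonneg zero_le_numeral)
  have meas [measurable]: "(\<lambda>t. ennreal (exp (b * t))) \<in> borel_measurable std_gaussian" for b
    by (subst measurable_cong_sets[OF sets_std_gaussian refl])
      (intro measurable_compose[OF _ measurable_ennreal] borel_measurable_continuous_onI continuous_intros)
  have integral_split: "(\<integral>\<^sup>+t. c * (ennreal (exp (p * t)) + (ennreal (exp (q * t)) + ennreal 2)) \<partial>std_gaussian) =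
      c * ((\<integral>\<^sup>+t. ennreal (exp (p * t)) \<partial>std_gaussian) +
      ((\<integral>\<^sup>+t. ennreal (exp (q * t)) \<partial>std_gaussian) + ennreal 2))" for c p q
    using emeasure_space_1
    by (subst nn_integral_cmult, (intro borel_measurable_add meas borel_measurable_const)[1])
      (simp add: nn_integral_add meas)
  have "(sign_lr s t)\<^sup>2 = ?c * (exp ((2 * s) * t) + (exp ((- 2 * s) * t) + 2))" for t
  proof -
    have "exp ((2 * s) * t) = (exp (s * t))\<^sup>2" "exp ((- 2 * s) * t) = (exp (- (s * t)))\<^sup>2"
      "exp (- s\<^sup>2) = (exp (- s\<^sup>2 / 2))\<^sup>2" "exp (s * t) * exp (- (s * t)) = 1"
      by (simp_all add: exp_double[symmetric] exp_add[symmetric] mult_ac)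
    moreover have "((u + v) / 2 * w)\<^sup>2 = w\<^sup>2 / 4 * (u\<^sup>2 + (v\<^sup>2 + 2 * (u * v)))" for u v w :: real
      by (simp add: power2_eq_square field_simps)
    ultimately show ?thesis
      by (simp add: sign_lr_def cosh_field_def)
  qed
  then have "(\<integral>\<^sup>+t. ennreal ((sign_lr s t)\<^sup>2) \<partial>std_gaussian) =
      (\<integral>\<^sup>+t. ennreal ?c * (ennreal (exp ((2 * s) * t)) + (ennreal (exp ((- 2 * s) * t)) + ennreal 2)) \<partial>std_gaussian)"
    by (intro nn_integral_cong) (simp only: split divide_nonneg_pos exp_ge_zero zero_less_numeral)
  also have "\<dots> = ennreal ?c * ((\<integral>\<^sup>+t. ennreal (exp ((2 * s) * t)) \<partial>std_gaussian) +
      ((\<integral>\<^sup>+t. ennreal (exp ((- 2 * s) * t)) \<partial>std_gaussian) + ennreal 2))"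
    by (rule integral_split)
  also have "\<dots> = ennreal (?c * (exp ((2 * s)\<^sup>2 / 2) + (exp ((- 2 * s)\<^sup>2 / 2) + 2)))"
    by (simp only: nn_integral_std_gaussian_exp split divide_nonneg_pos exp_ge_zero zero_less_numeral)
  also have "?c * (exp ((2 * s)\<^sup>2 / 2) + (exp ((- 2 * s)\<^sup>2 / 2) + 2)) = cosh (s\<^sup>2)"
  proof -
    have "exp ((2 * s)\<^sup>2 / 2) = (exp (s\<^sup>2))\<^sup>2" "exp ((- 2 * s)\<^sup>2 / 2) = (exp (s\<^sup>2))\<^sup>2"
      by (simp_all add: power2_eq_square exp_add[symmetric])
    then show ?thesis
      by (simp add: cosh_field_def exp_minus field_simps power2_eq_square)
  qed
  finally show ?thesis .
qed

section \<open>Transfer between the noise and its law\<close>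

lemma gaussian_noise_measurable:
  assumes "gaussian_noise M \<xi>"
  shows "\<xi> n \<in> borel_measurable M"
  using assms by (auto simp: gaussian_noise_def dest!: spec[of _ n] distributed_measurable)

lemma gaussian_noise_distr:
  assumes "gaussian_noise M \<xi>"
  shows "distr M borel (\<xi> n) = std_gaussian"
proof -
  have "distr M lborel (\<xi> n) = std_gaussian"
    using assms by (auto simp: gaussian_noise_def std_gaussian_def distributed_def)
  then show ?thesis
    by (metis distr_cong sets_lborel)
qed

lemma gaussian_noise_seq_measurable:
  assumes "gaussian_noise M \<xi>"
  shows "(\<lambda>\<omega> n. \<xi> n \<omega>) \<in> borel_measurable M"
  by (rule borel_measurable_seqI) (rule gaussian_noise_measurable[OF assms])

text \<open>Independence means precisely that the joint law is the product of the marginal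
  laws.\<close>

lemma gaussian_noise_seq_distr:
  assumes "gaussian_noise M \<xi>"
  shows "distr M borel (\<lambda>\<omega> n. \<xi> n \<omega>) = gaussian_seq"
proof -
  interpret prob_space M using assms by (simp add: gaussian_noise_def)
  have "distr M (\<Pi>\<^sub>M n\<in>UNIV. borel) (\<lambda>\<omega>. \<lambda>n\<in>UNIV. \<xi> n \<omega>) = (\<Pi>\<^sub>M n\<in>UNIV. distr M borel (\<xi> n))"
    using assms gaussian_noise_measurable[OF assms]
    by (subst indep_vars_iff_distr_eq_PiM[symmetric]) (auto simp: gaussian_noise_def)
  then have "distr M (\<Pi>\<^sub>M n\<in>UNIV. borel) (\<lambda>\<omega> n. \<xi> n \<omega>) = gaussian_seq"
    by (simp add: gaussian_noise_distr[OF assms] gaussian_seq_def restrict_def)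
  then show ?thesis
    by (metis distr_cong sets_PiM_equal_borel)
qed

text \<open>Almost sure statements about the noise depend on its law alone, so detection can be
  studied on sequence space.\<close>

lemma AE_gaussian_seq_iff:
  assumes "gaussian_noise M \<xi>" "{y. P y} \<in> sets borel"
  shows "(AE y in gaussian_seq. P y) \<longleftrightarrow> (AE \<omega> in M. P (\<lambda>n. \<xi> n \<omega>))"
  unfolding gaussian_noise_seq_distr[OF assms(1), symmetric]
  using assms(2) by (subst AE_distr_iff) (auto intro: gaussian_noise_seq_measurable[OF assms(1)])

text \<open>The squared likelihood ratio is a product over coordinates, so by independence its mean
  is the product of the numbers \<open>cosh ((\<sigma> n)\<^sup>2)\<close>. The bound is uniform in
  \<open>N\<close>.\<close>

lemma nn_integral_likelihood_square_le:
  assumes noise: "gaussian_noise M \<xi>" and summable: "summable (\<lambda>n. \<sigma> n ^ 4)"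
  shows "(\<integral>\<^sup>+y. ennreal ((\<Prod>n<N. sign_lr (\<sigma> n) (y n))\<^sup>2) \<partial>gaussian_seq) \<le> ennreal (exp (\<Sum>n. \<sigma> n ^ 4))"
proof -
  interpret prob_space M using noise by (simp add: gaussian_noise_def)
  note [measurable] = gaussian_noise_measurable[OF noise] gaussian_noise_seq_measurable[OF noise]
  let ?X = "\<lambda>n \<omega>. ennreal ((sign_lr (\<sigma> n) (\<xi> n \<omega>))\<^sup>2)"
  have "(\<integral>\<^sup>+y. ennreal ((\<Prod>n<N. sign_lr (\<sigma> n) (y n))\<^sup>2) \<partial>gaussian_seq) =
      (\<integral>\<^sup>+\<omega>. ennreal ((\<Prod>n<N. sign_lr (\<sigma> n) (\<xi> n \<omega>))\<^sup>2) \<partial>M)"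
    unfolding gaussian_noise_seq_distr[OF noise, symmetric] by (subst nn_integral_distr) auto
  also have "\<dots> = (\<integral>\<^sup>+\<omega>. (\<Prod>n<N. ?X n \<omega>) \<partial>M)"
    by (simp add: prod_power_distrib prod_ennreal)
  also have "\<dots> = (\<Prod>n<N. \<integral>\<^sup>+\<omega>. ?X n \<omega> \<partial>M)"
  proof (rule indep_vars_nn_integral)
    have "indep_vars (\<lambda>_. borel) \<xi> {..<N}"
      using noise by (auto simp: gaussian_noise_def intro: indep_vars_subset)
    then show "indep_vars (\<lambda>_. borel) ?X {..<N}"
      by (rule indep_vars_compose2) simp
  qed auto
  also have "\<dots> = (\<Prod>n<N. ennreal (cosh ((\<sigma> n)\<^sup>2)))"
  proof (rule prod.cong[OF refl])
    fix n
    have "(\<integral>\<^sup>+\<omega>. ?X n \<omega> \<partial>M) = (\<integral>\<^sup>+t. ennreal ((sign_lr (\<sigma> n) t)\<^sup>2) \<partial>distr M borel (\<xi> n))"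
      by (subst nn_integral_distr) auto
    then show "(\<integral>\<^sup>+\<omega>. ?X n \<omega> \<partial>M) = ennreal (cosh ((\<sigma> n)\<^sup>2))"
      by (simp add: gaussian_noise_distr[OF noise] nn_integral_sign_lr_square)
  qed
  also have "\<dots> = ennreal (\<Prod>n<N. cosh ((\<sigma> n)\<^sup>2))"
    by (rule prod_ennreal) (simp add: cosh_real_nonneg)
  also have "\<dots> \<le> ennreal (exp (\<Sum>n. \<sigma> n ^ 4))"
  proof (rule ennreal_leI)
    have "(\<Prod>n<N. cosh ((\<sigma> n)\<^sup>2)) \<le> (\<Prod>n<N. exp (\<sigma> n ^ 4))"
    proof (rule prod_mono)
      fix n
      have "((\<sigma> n)\<^sup>2)\<^sup>2 = \<sigma> n ^ 4" by (simp add: power_mult[symmetric])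
      then show "0 \<le> cosh ((\<sigma> n)\<^sup>2) \<and> cosh ((\<sigma> n)\<^sup>2) \<le> exp (\<sigma> n ^ 4)"
        using cosh_le_exp_square[of "(\<sigma> n)\<^sup>2"] by (simp add: cosh_real_nonneg)
    qed
    also have "\<dots> = exp (\<Sum>n<N. \<sigma> n ^ 4)" by (simp add: exp_sum)
    also have "\<dots> \<le> exp (\<Sum>n. \<sigma> n ^ 4)"
      using sum_le_suminf[OF summable, of "{..<N}"] by simp
    finally show "(\<Prod>n<N. cosh ((\<sigma> n)\<^sup>2)) \<le> exp (\<Sum>n. \<sigma> n ^ 4)" .
  qed
  finally show ?thesis .
qed

section \<open>Open sets, compactness and the undetected signal\<close>

lemma nn_integral_indicator_shift:
  fixes z :: "nat \<Rightarrow> real"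
  assumes [measurable]: "U \<in> sets borel"
  shows "(\<integral>\<^sup>+y. indicator U (\<lambda>n. z n + y n) \<partial>gaussian_seq) =
    emeasure gaussian_seq {y. (\<lambda>n. z n + y n) \<in> U}"
proof -
  note borel_measurable_seq_add [measurable]
  have "(\<integral>\<^sup>+y. indicator U (\<lambda>n. z n + y n) \<partial>gaussian_seq) =
      (\<integral>\<^sup>+y. indicator {y. (\<lambda>n. z n + y n) \<in> U} y \<partial>gaussian_seq)"
    by (intro nn_integral_cong) (simp split: split_indicator)
  also have "\<dots> = emeasure gaussian_seq {y. (\<lambda>n. z n + y n) \<in> U}"
    by (rule nn_integral_indicator) simp
  finally show ?thesis .
qed

text \<open>For open \<open>U\<close> the shift probability is lower semicontinuous in the shift: if
  \<open>l + y\<close> lies in \<open>U\<close>, so does \<open>x k + y\<close> for all large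
  \<open>k\<close>, and Fatou's lemma applies to the indicators.\<close>

lemma emeasure_open_shift_le_of_tendsto:
  fixes x :: "nat \<Rightarrow> nat \<Rightarrow> real"
  assumes U: "open U" and lim: "x \<longlonglongrightarrow> l"
    and le: "\<And>k. emeasure gaussian_seq {y. (\<lambda>n. x k n + y n) \<in> U} \<le> c"
  shows "emeasure gaussian_seq {y. (\<lambda>n. l n + y n) \<in> U} \<le> c"
proof -
  have [measurable]: "U \<in> sets borel" using U by simp
  note borel_measurable_seq_add [measurable]
  note int = nn_integral_indicator_shift[OF \<open>U \<in> sets borel\<close>]
  have "(\<integral>\<^sup>+y. indicator U (\<lambda>n. l n + y n) \<partial>gaussian_seq) \<le>
      (\<integral>\<^sup>+y. liminf (\<lambda>k. indicator U (\<lambda>n. x k n + y n)) \<partial>gaussian_seq)"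
  proof (rule nn_integral_mono)
    fix y :: "nat \<Rightarrow> real"
    show "indicator U (\<lambda>n. l n + y n) \<le> liminf (\<lambda>k. indicator U (\<lambda>n. x k n + y n) :: ennreal)"
    proof (cases "(\<lambda>n. l n + y n) \<in> U")
      case True
      have "continuous_on UNIV (\<lambda>z::nat \<Rightarrow> real. \<lambda>n. z n + y n)"
        by (intro continuous_intros continuous_on_product_coordinates)
      then have "(\<lambda>k n. x k n + y n) \<longlonglongrightarrow> (\<lambda>n. l n + y n)"
        by (rule continuous_on_tendsto_compose[OF _ lim]) auto
      then have "\<forall>\<^sub>F k in sequentially. (\<lambda>n. x k n + y n) \<in> U"
        using U True by (rule topological_tendstoD)
      then have "1 \<le> liminf (\<lambda>k. indicator U (\<lambda>n. x k n + y n) :: ennreal)"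
        by (intro Liminf_bounded) (auto elim: eventually_mono)
      then show ?thesis using True by simp
    qed simp
  qed
  also have "\<dots> \<le> liminf (\<lambda>k. \<integral>\<^sup>+y. indicator U (\<lambda>n. x k n + y n) \<partial>gaussian_seq)"
    by (rule nn_integral_liminf) auto
  also have "\<dots> \<le> liminf (\<lambda>k. c)"
    using le by (intro Liminf_mono) (simp add: int)
  finally show ?thesis by (simp add: int Liminf_const)
qed

text \<open>The truncated signals lie in a product of finite sets, which is compact and hence
  sequentially compact here. Each coordinate is eventually untruncated, so its limit is again one of
  the two signs.\<close>

lemma truncated_signs_convergent_subsequence:
  assumes "\<And>N. x N \<in> rademacher_space \<sigma>"
  obtains r l where "strict_mono (r :: nat \<Rightarrow> nat)" "l \<in> rademacher_space \<sigma>"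
    "(\<lambda>k n. if n < r k then x (r k) n else 0) \<longlonglongrightarrow> l"
proof -
  let ?S = "\<lambda>n. {\<sigma> n, - \<sigma> n, 0}"
  let ?f = "\<lambda>N n. if n < N then x N n else 0"
  \<comment> \<open>The value 0 belongs to \<open>?S n\<close> to accommodate truncated
    coordinates.\<close>
  have "compact (PiE UNIV ?S)"
    using compactin_PiE[of "\<lambda>_. euclidean" UNIV ?S]
    by (simp add: euclidean_product_topology finite_imp_compact)
  then have "seq_compact (PiE UNIV ?S)" by (rule compact_imp_seq_compact)
  moreover have "\<forall>N. ?f N \<in> PiE UNIV ?S"
    using assms unfolding rademacher_space_def by fastforce
  ultimately obtain l r where r: "strict_mono (r :: nat \<Rightarrow> nat)" and lim: "(?f \<circ> r) \<longlonglongrightarrow> l"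
    by (rule seq_compactE)
  have "l n \<in> {\<sigma> n, - \<sigma> n}" for n
  proof (rule Lim_in_closed_set)
    show "\<forall>\<^sub>F k in sequentially. (?f \<circ> r) k n \<in> {\<sigma> n, - \<sigma> n}"
    proof (rule eventually_sequentiallyI[of "Suc n"])
      fix k assume "Suc n \<le> k"
      then have "n < r k" using seq_suble[OF r, of k] by simp
      then show "(?f \<circ> r) k n \<in> {\<sigma> n, - \<sigma> n}"
        using assms[of "r k"] by (simp add: rademacher_space_def)
    qed
    show "(\<lambda>k. (?f \<circ> r) k n) \<longlonglongrightarrow> l n"
      by (rule continuous_on_tendsto_compose[OF continuous_on_product_coordinates lim]) auto
  qed auto
  then have "l \<in> rademacher_space \<sigma>" by (simp add: rademacher_space_def)
  then show ?thesis
    by (rule that[OF r]) (use lim in \<open>simp add: comp_def\<close>)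
qed

text \<open>\<open>B\<close> stands for the region where a test announces a signal; having noise
  measure 0, it has open supersets of arbitrarily small noise measure.\<close>

lemma exists_signs_not_detected:
  assumes noise: "gaussian_noise M \<xi>" and summable: "summable (\<lambda>n. \<sigma> n ^ 4)"
    and B: "B \<in> sets borel" "emeasure gaussian_seq B = 0"
  shows "\<exists>x\<in>rademacher_space \<sigma>. \<not> (AE y in gaussian_seq. (\<lambda>n. x n + y n) \<in> B)"
proof -
  interpret G: prob_space gaussian_seq by (rule prob_space_gaussian_seq)
  define C where "C = exp (\<Sum>n. \<sigma> n ^ 4)"
  have C: "0 < C" by (simp add: C_def)
  have "(INF U \<in> {U. B \<subseteq> U \<and> open U}. emeasure gaussian_seq U) = 0"
    using outer_regular[of gaussian_seq B] B by simp
  \<comment> \<open>The constant makes both terms of the estimate below equal to 1/4: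
    \<open>4 * C\<close> times \<open>1 / (16 * C)\<close>, and \<open>1 / (4 * C)\<close> times the
    second moment bound \<open>C\<close>.\<close>
  then have "(INF U \<in> {U. B \<subseteq> U \<and> open U}. emeasure gaussian_seq U) < ennreal (1 / (16 * C))"
    using C by simp
  then obtain U where U: "B \<subseteq> U" "open U" "emeasure gaussian_seq U < ennreal (1 / (16 * C))"
    by (auto simp: INF_less_iff)
  have [measurable]: "U \<in> sets borel" using U by simp
  note borel_measurable_seq_add [measurable]
  have "\<exists>x\<in>rademacher_space \<sigma>.
      emeasure gaussian_seq {y. (\<lambda>n. (if n < N then x n else 0) + y n) \<in> U} \<le> ennreal (1 / 2)" for N
  proof -
    let ?L = "\<lambda>y. \<Prod>n<N. sign_lr (\<sigma> n) (y n)"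
    obtain x where x: "x \<in> rademacher_space \<sigma>" and
      le: "(\<integral>\<^sup>+y. indicator U (\<lambda>n. (if n < N then x n else 0) + y n) \<partial>gaussian_seq) \<le>
        (\<integral>\<^sup>+y. indicator U y * (\<Prod>n<N. ennreal (sign_lr (\<sigma> n) (y n))) \<partial>gaussian_seq)"
      using exists_signs_truncated_shift_le[of "indicator U" \<sigma> N] by auto
    note le
    also have "(\<integral>\<^sup>+y. indicator U y * (\<Prod>n<N. ennreal (sign_lr (\<sigma> n) (y n))) \<partial>gaussian_seq) \<le>
        (\<integral>\<^sup>+y. ennreal (4 * C) * indicator U y + ennreal (1 / (4 * C)) * ennreal ((?L y)\<^sup>2) \<partial>gaussian_seq)"
    proof (rule nn_integral_mono)
      fix y :: "nat \<Rightarrow> real"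
      have L: "0 \<le> ?L y" by (intro prod_nonneg sign_lr_nonneg)
      \<comment> \<open>Splitting at the level \<open>4 * C\<close> takes the place of the
        Cauchy-Schwarz inequality: below it the first term dominates, above it the second.\<close>
      have "?L y \<le> 4 * C + 1 / (4 * C) * (?L y)\<^sup>2"
      proof (cases "?L y \<le> 4 * C")
        case True
        then show ?thesis using C by (intro order_trans[OF True]) simp
      next
        case False
        then have "4 * C * ?L y \<le> ?L y * ?L y" using L by (intro mult_right_mono) auto
        then have "?L y \<le> 1 / (4 * C) * (?L y)\<^sup>2"
          using C by (simp add: field_simps power2_eq_square)
        then show ?thesis using C by linarith
      qed
      then have "ennreal (?L y) \<le> ennreal (4 * C) + ennreal (1 / (4 * C)) * ennreal ((?L y)\<^sup>2)"
        using C by (simp add: ennreal_mult[symmetric] ennreal_plus[symmetric] ennreal_leI del: ennreal_plus)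
      then show "indicator U y * (\<Prod>n<N. ennreal (sign_lr (\<sigma> n) (y n))) \<le>
          ennreal (4 * C) * indicator U y + ennreal (1 / (4 * C)) * ennreal ((?L y)\<^sup>2)"
        by (simp add: prod_ennreal sign_lr_nonneg split: split_indicator)
    qed
    also have "\<dots> = ennreal (4 * C) * emeasure gaussian_seq U +
        ennreal (1 / (4 * C)) * (\<integral>\<^sup>+y. ennreal ((?L y)\<^sup>2) \<partial>gaussian_seq)"
      by (subst nn_integral_add) (auto simp: nn_integral_cmult)
    also have "\<dots> \<le> ennreal (4 * C) * ennreal (1 / (16 * C)) + ennreal (1 / (4 * C)) * ennreal C"
      using U(3) nn_integral_likelihood_square_le[OF noise summable, of N]
      by (intro add_mono mult_left_mono) (auto simp: C_def)
    also have "\<dots> = ennreal (1 / 2)"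
      using C by (simp add: ennreal_mult[symmetric] ennreal_plus[symmetric] del: ennreal_plus)
    also have "(\<integral>\<^sup>+y. indicator U (\<lambda>n. (if n < N then x n else 0) + y n) \<partial>gaussian_seq) =
        emeasure gaussian_seq {y. (\<lambda>n. (if n < N then x n else 0) + y n) \<in> U}"
      by (rule nn_integral_indicator_shift) simp
    finally show ?thesis using x by blast
  qed
  then obtain x where x: "\<And>N. x N \<in> rademacher_space \<sigma>" and
    small: "\<And>N. emeasure gaussian_seq {y. (\<lambda>n. (if n < N then x N n else 0) + y n) \<in> U} \<le> ennreal (1 / 2)"
    by metis
  obtain r l where l: "l \<in> rademacher_space \<sigma>" and
    lim: "(\<lambda>k n. if n < r k then x (r k) n else 0) \<longlonglongrightarrow> l"
    by (rule truncated_signs_convergent_subsequence[of x \<sigma>, OF x])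
  have half: "emeasure gaussian_seq {y. (\<lambda>n. l n + y n) \<in> U} \<le> ennreal (1 / 2)"
    by (rule emeasure_open_shift_le_of_tendsto[OF U(2) lim]) (rule small)
  have "\<not> (AE y in gaussian_seq. (\<lambda>n. l n + y n) \<in> B)"
  proof
    assume "AE y in gaussian_seq. (\<lambda>n. l n + y n) \<in> B"
    then have "AE y in gaussian_seq. (\<lambda>n. l n + y n) \<in> U"
      using U(1) by (auto elim: eventually_mono)
    then have "emeasure gaussian_seq {y \<in> space gaussian_seq. (\<lambda>n. l n + y n) \<in> U} = 1"
      by (intro G.emeasure_eq_1_AE) auto
    then have "ennreal 1 \<le> ennreal (1 / 2)" using half by (simp only: ennreal_1 space_gaussian_seq UNIV_I simp_thms)
    then show False by (subst (asm) ennreal_le_iff) auto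
  qed
  then show ?thesis using l by blast
qed

subsection \<open>Detection by a weighted energy statistic\<close>

text \<open>Independent centered variables are orthogonal, so the cross terms vanish when a summand
  is added.\<close>

lemma (in prob_space) centered_indep_sum_second_moment:
  fixes Z :: "nat \<Rightarrow> 'a \<Rightarrow> real"
  assumes indep: "indep_vars (\<lambda>_. borel) Z UNIV"
    and sq: "\<And>n. integrable M (\<lambda>\<omega>. (Z n \<omega>)\<^sup>2)"
    and mean: "\<And>n. expectation (Z n) = 0"
  shows "integrable M (\<lambda>\<omega>. (\<Sum>n<N. Z n \<omega>)\<^sup>2)"
    and "expectation (\<lambda>\<omega>. (\<Sum>n<N. Z n \<omega>)\<^sup>2) = (\<Sum>n<N. expectation (\<lambda>\<omega>. (Z n \<omega>)\<^sup>2))"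
proof (induction N)
  case (Suc N)
  have [measurable]: "Z n \<in> borel_measurable M" for n
    using indep by (auto simp: indep_vars_def)
  have int: "integrable M (Z n)" for n
    by (rule square_integrable_imp_integrable[OF _ sq]) simp
  have cross: "integrable M (\<lambda>\<omega>. Z i \<omega> * Z N \<omega>)" "expectation (\<lambda>\<omega>. Z i \<omega> * Z N \<omega>) = 0" if "i < N" for i
  proof -
    \<comment> \<open>Since \<open>i < N\<close>, the product over \<open>{i, N}\<close> has two
      distinct factors and its mean is the product of the means.\<close>
    have ind: "indep_vars (\<lambda>_. borel) Z {i, N}" by (rule indep_vars_subset[OF indep]) simp
    show "integrable M (\<lambda>\<omega>. Z i \<omega> * Z N \<omega>)"
      using indep_vars_integrable[OF _ ind int] that by simp
    show "expectation (\<lambda>\<omega>. Z i \<omega> * Z N \<omega>) = 0"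
      using indep_vars_lebesgue_integral[OF _ ind int] that by (simp add: mean)
  qed
  have eq: "(\<Sum>n<Suc N. Z n \<omega>)\<^sup>2 = (\<Sum>n<N. Z n \<omega>)\<^sup>2 + (Z N \<omega>)\<^sup>2 + 2 * (\<Sum>n<N. Z n \<omega> * Z N \<omega>)" for \<omega>
    by (simp add: power2_sum sum_distrib_right)
  have sum_cross: "integrable M (\<lambda>\<omega>. \<Sum>n<N. Z n \<omega> * Z N \<omega>)"
    "expectation (\<lambda>\<omega>. \<Sum>n<N. Z n \<omega> * Z N \<omega>) = 0"
    using cross by (auto simp: Bochner_Integration.integral_sum intro!: Bochner_Integration.integrable_sum)
  show "integrable M (\<lambda>\<omega>. (\<Sum>n<Suc N. Z n \<omega>)\<^sup>2)"
    unfolding eq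
    by (intro Bochner_Integration.integrable_add integrable_mult_right Suc sq sum_cross)
  show "expectation (\<lambda>\<omega>. (\<Sum>n<Suc N. Z n \<omega>)\<^sup>2) = (\<Sum>n<Suc N. expectation (\<lambda>\<omega>. (Z n \<omega>)\<^sup>2))"
    unfolding eq using Suc sq cross sum_cross by simp
qed simp_all

text \<open>Chebyshev's inequality bounds the probability of the k-th deviation by the k-th term of
  the summable series, and Borel-Cantelli concludes.\<close>

lemma (in prob_space) centered_indep_sum_eventually_small:
  fixes Z :: "nat \<Rightarrow> 'a \<Rightarrow> real"
  assumes indep: "indep_vars (\<lambda>_. borel) Z UNIV"
    and sq: "\<And>n. integrable M (\<lambda>\<omega>. (Z n \<omega>)\<^sup>2)"
    and mean: "\<And>n. expectation (Z n) = 0"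
    and t: "\<And>k. 0 < t k"
    and summable: "summable (\<lambda>k. (\<Sum>n<N k. expectation (\<lambda>\<omega>. (Z n \<omega>)\<^sup>2)) / (t k)\<^sup>2)"
  shows "AE \<omega> in M. \<forall>\<^sub>F k in sequentially. \<bar>\<Sum>n<N k. Z n \<omega>\<bar> < t k"
proof -
  have [measurable]: "Z n \<in> borel_measurable M" for n
    using indep by (auto simp: indep_vars_def)
  let ?A = "\<lambda>k. {\<omega> \<in> space M. \<bar>\<Sum>n<N k. Z n \<omega>\<bar> \<ge> t k}"
  note moment = centered_indep_sum_second_moment[OF indep sq mean]
  have "AE \<omega> in M. \<forall>\<^sub>F k in sequentially. \<omega> \<in> space M - ?A k"
  proof (rule borel_cantelli_AE1)
    have "prob (?A k) \<le> (\<Sum>n<N k. expectation (\<lambda>\<omega>. (Z n \<omega>)\<^sup>2)) / (t k)\<^sup>2" for k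
      using second_moment_method[of "\<lambda>\<omega>. \<Sum>n<N k. Z n \<omega>" "t k"] moment[of "N k"] t[of k] by simp
    then show "summable (\<lambda>k. prob (?A k))"
      by (intro summable_comparison_test'[OF summable, of 0]) simp
  qed (auto simp: emeasure_eq_measure)
  then show ?thesis
    by (rule AE_mp) (auto intro!: AE_I2 elim!: eventually_mono simp: not_le)
qed

section \<open>The energy statistic\<close>

text \<open>\<open>Z\<close> is the centered version of \<open>a * ((x + X)\<^sup>2 - 1)\<close>,
  whose mean is \<open>a * x\<^sup>2\<close>. Its moments follow from those of \<open>X\<close> up
  to order 4.\<close>

lemma std_gaussian_chi_square_moments:
  fixes X :: "'a \<Rightarrow> real" and a x :: real
  assumes "distributed M lborel X (\<lambda>x. ennreal (std_normal_density x))"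
  defines "Z \<equiv> \<lambda>\<omega>. a * ((X \<omega>)\<^sup>2 - 1 + 2 * x * X \<omega>)"
  shows "integrable M (\<lambda>\<omega>. (Z \<omega>)\<^sup>2)" "(\<integral>\<omega>. Z \<omega> \<partial>M) = 0"
    "(\<integral>\<omega>. (Z \<omega>)\<^sup>2 \<partial>M) = a\<^sup>2 * (2 + 4 * x\<^sup>2)"
proof -
  have mom: "integrable M (\<lambda>\<omega>. X \<omega> ^ k)"
    "(\<integral>\<omega>. X \<omega> ^ k \<partial>M) = (\<integral>t. std_normal_density t * t ^ k \<partial>lborel)" for k
    using distributed_integrable[OF assms(1), of "\<lambda>t. t ^ k"] integrable_std_normal_moment[of k]
      distributed_integral[OF assms(1), of "\<lambda>t. t ^ k"] by simp_all
  have m: "(\<integral>\<omega>. X \<omega> ^ 0 \<partial>M) = 1" "(\<integral>\<omega>. X \<omega> ^ 1 \<partial>M) = 0" "(\<integral>\<omega>. X \<omega> ^ 2 \<partial>M) = 1"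
    "(\<integral>\<omega>. X \<omega> ^ 3 \<partial>M) = 0" "(\<integral>\<omega>. X \<omega> ^ 4 \<partial>M) = 3"
    unfolding mom
    using integral_std_normal_moment_even[of 0] integral_std_normal_moment_even[of 1]
      integral_std_normal_moment_even[of 2] integral_std_normal_moment_odd[of 0]
      integral_std_normal_moment_odd[of 1]
    by (simp_all add: fact_numeral)
  \<comment> \<open>Constant and linear terms are kept as powers 0 and 1, so that all terms are
    covered by the facts \<open>m\<close> and \<open>mom\<close>; this is why the simplifier must
    not rewrite these powers below.\<close>
  have sq: "(Z \<omega>)\<^sup>2 = a\<^sup>2 * (X \<omega> ^ 4 + 4 * x * X \<omega> ^ 3 + (4 * x\<^sup>2 - 2) * X \<omega> ^ 2 - 4 * x * X \<omega> ^ 1 + X \<omega> ^ 0)" for \<omega>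
    by (simp add: Z_def power2_eq_square power3_eq_cube power4_eq_xxxx algebra_simps)
  have lin: "Z \<omega> = a * (X \<omega> ^ 2 - X \<omega> ^ 0 + 2 * x * X \<omega> ^ 1)" for \<omega>
    by (simp add: Z_def)
  have i: "integrable M (\<lambda>\<omega>. c * X \<omega> ^ k)" for c k using mom(1)[of k] by simp
  show "integrable M (\<lambda>\<omega>. (Z \<omega>)\<^sup>2)"
    unfolding sq by (intro integrable_mult_right Bochner_Integration.integrable_add Bochner_Integration.integrable_diff mom(1))
  show "(\<integral>\<omega>. Z \<omega> \<partial>M) = 0"
    unfolding lin using m mom(1) i
    by (simp add: Bochner_Integration.integral_add Bochner_Integration.integral_diff del: power_0 power_one_right One_nat_def)
  show "(\<integral>\<omega>. (Z \<omega>)\<^sup>2 \<partial>M) = a\<^sup>2 * (2 + 4 * x\<^sup>2)"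
    unfolding sq using m mom(1) i
    by (simp add: Bochner_Integration.integral_add Bochner_Integration.integral_diff del: power_0 power_one_right One_nat_def)
qed

text \<open>If the truncated series converged, its terms would eventually be below 1, where
  truncation changes nothing, and the original series would converge too.\<close>

lemma not_summable_truncated_square:
  fixes \<sigma> :: "nat \<Rightarrow> real"
  assumes "\<not> summable (\<lambda>n. \<sigma> n ^ 4)"
  shows "\<not> summable (\<lambda>n. (min ((\<sigma> n)\<^sup>2) 1)\<^sup>2)"
proof
  assume summable: "summable (\<lambda>n. (min ((\<sigma> n)\<^sup>2) 1)\<^sup>2)"
  then have "\<forall>\<^sub>F n in sequentially. (min ((\<sigma> n)\<^sup>2) 1)\<^sup>2 < 1"
    by (intro order_tendstoD(2)[OF summable_LIMSEQ_zero]) auto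
  then have "\<forall>\<^sub>F n in sequentially. (min ((\<sigma> n)\<^sup>2) 1)\<^sup>2 = \<sigma> n ^ 4"
  proof (rule eventually_mono)
    fix n
    assume less: "(min ((\<sigma> n)\<^sup>2) 1)\<^sup>2 < 1"
    have "min ((\<sigma> n)\<^sup>2) 1 = (\<sigma> n)\<^sup>2"
    proof (rule min_absorb1, rule ccontr)
      assume "\<not> (\<sigma> n)\<^sup>2 \<le> 1"
      then have "min ((\<sigma> n)\<^sup>2) 1 = 1" by simp
      with less show False by simp
    qed
    then show "(min ((\<sigma> n)\<^sup>2) 1)\<^sup>2 = \<sigma> n ^ 4"
      by (simp only: power_mult[symmetric]) simp
  qed
  from summable_cong[OF this] summable assms show False by simp
qed

text \<open>One test serves all signals because the mean of the statistic depends on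
  \<open>x n\<close> through its square only. Capping the weights at 1 keeps the variance within a
  constant multiple of the mean even for large \<open>\<sigma> n\<close>.\<close>

lemma admits_detection_rademacher_space:
  assumes noise: "gaussian_noise M \<xi>" and not_summable: "\<not> summable (\<lambda>n. \<sigma> n ^ 4)"
  shows "admits_detection M \<xi> (rademacher_space \<sigma>)"
proof -
  interpret prob_space M using noise by (simp add: gaussian_noise_def)
  have indep: "indep_vars (\<lambda>_. borel) \<xi> UNIV"
    and dist: "\<And>n. distributed M lborel (\<xi> n) (\<lambda>x. ennreal (std_normal_density x))"
    using noise by (auto simp: gaussian_noise_def)
  define a where "a n = min ((\<sigma> n)\<^sup>2) 1" for n
  define A where "A N = (\<Sum>n<N. (a n)\<^sup>2)" for N
  have a: "0 \<le> a n" "a n \<le> 1" "a n \<le> (\<sigma> n)\<^sup>2" for n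
    by (simp_all add: a_def)
  have "\<exists>N. 2 ^ k \<le> A N" for k
  proof (rule ccontr)
    assume "\<not> ?thesis"
    then have "summable (\<lambda>n. (a n)\<^sup>2)"
      by (intro summableI_nonneg_bounded[where x = "2 ^ k"]) (auto simp: A_def not_le less_imp_le)
    then show False
      using not_summable_truncated_square[OF not_summable] by (simp add: a_def)
  qed
  then obtain N where N: "\<And>k. 2 ^ k \<le> A (N k)" by metis
  \<comment> \<open>One concentration estimate covers both hypotheses: pure noise with
    \<open>x = 0\<close> and \<open>t k = A (N k)\<close>, and a signal with \<open>t k\<close> the
    mean of the statistic. Exponential growth of \<open>t k\<close> makes the Chebyshev bounds
    summable.\<close>
  have small: "AE \<omega> in M. \<forall>\<^sub>F k in sequentially.
      \<bar>\<Sum>n<N k. a n * ((\<xi> n \<omega>)\<^sup>2 - 1 + 2 * x n * \<xi> n \<omega>)\<bar> < t k / 2"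
    if t: "\<And>k. 2 ^ k \<le> t k" and V: "\<And>k. (\<Sum>n<N k. (a n)\<^sup>2 * (2 + 4 * (x n)\<^sup>2)) \<le> 6 * t k" for x t
  proof -
    note moments = std_gaussian_chi_square_moments[OF dist]
    have t_pos: "0 < t k" for k using less_le_trans[OF _ t[of k], of 0] by simp
    show ?thesis
    proof (rule centered_indep_sum_eventually_small)
      show "indep_vars (\<lambda>_. borel) (\<lambda>n \<omega>. a n * ((\<xi> n \<omega>)\<^sup>2 - 1 + 2 * x n * \<xi> n \<omega>)) UNIV"
        by (rule indep_vars_compose2[OF indep, of "\<lambda>n t. a n * (t\<^sup>2 - 1 + 2 * x n * t)"]) simp
      show "summable (\<lambda>k. (\<Sum>n<N k. expectation (\<lambda>\<omega>. (a n * ((\<xi> n \<omega>)\<^sup>2 - 1 + 2 * x n * \<xi> n \<omega>))\<^sup>2)) / (t k / 2)\<^sup>2)"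
      proof (rule summable_comparison_test'[of "\<lambda>k. 24 * (1 / 2) ^ k" 0])
        fix k :: nat
        have "(\<Sum>n<N k. (a n)\<^sup>2 * (2 + 4 * (x n)\<^sup>2)) / (t k / 2)\<^sup>2 \<le> 6 * t k / (t k / 2)\<^sup>2"
          by (intro divide_right_mono V) simp
        also have "\<dots> = 24 / t k" using t_pos[of k] by (simp add: field_simps power2_eq_square)
        also have "\<dots> \<le> 24 / 2 ^ k" using t[of k] by (intro divide_left_mono) (auto intro: mult_pos_pos t_pos)
        finally show "norm ((\<Sum>n<N k. expectation (\<lambda>\<omega>. (a n * ((\<xi> n \<omega>)\<^sup>2 - 1 + 2 * x n * \<xi> n \<omega>))\<^sup>2)) / (t k / 2)\<^sup>2) \<le> 24 * (1 / 2) ^ k"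
          unfolding moments(3)
          by (subst real_norm_def, subst abs_of_nonneg) (auto intro!: sum_nonneg divide_nonneg_nonneg simp: power_one_over)
      qed (intro summable_mult summable_geometric, simp)
      show "integrable M (\<lambda>\<omega>. (a n * ((\<xi> n \<omega>)\<^sup>2 - 1 + 2 * x n * \<xi> n \<omega>))\<^sup>2)"
        and "expectation (\<lambda>\<omega>. a n * ((\<xi> n \<omega>)\<^sup>2 - 1 + 2 * x n * \<xi> n \<omega>)) = 0" for n
        by (rule moments)+
    qed (use t_pos in simp)
  qed
  \<comment> \<open>The threshold lies halfway between the noise mean 0 and the lower bound
    \<open>A (N k)\<close> for the mean under a signal.\<close>
  define E where "E y \<longleftrightarrow> (\<forall>\<^sub>F k in sequentially. A (N k) / 2 < (\<Sum>n<N k. a n * ((y n)\<^sup>2 - 1)))"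
    for y :: "nat \<Rightarrow> real"
  have [measurable]: "Measurable.pred borel E"
    unfolding E_def eventually_sequentially by measurable
  have "(\<lambda>y. if E y then 1 else 0) \<in> borel \<rightarrow>\<^sub>M count_space {0, 1 :: nat}"
    by measurable
  moreover have "AE \<omega> in M. (if E (\<lambda>n. \<xi> n \<omega>) then 1 else 0) = (0 :: nat)"
  proof -
    have "AE \<omega> in M. \<forall>\<^sub>F k in sequentially. \<bar>\<Sum>n<N k. a n * ((\<xi> n \<omega>)\<^sup>2 - 1 + 2 * 0 * \<xi> n \<omega>)\<bar> < A (N k) / 2"
    proof (rule small[of "\<lambda>k. A (N k)" "\<lambda>_. 0"])
      fix k
      have "0 \<le> A (N k)" by (auto simp: A_def intro: sum_nonneg)
      then show "(\<Sum>n<N k. (a n)\<^sup>2 * (2 + 4 * 0\<^sup>2)) \<le> 6 * A (N k)"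
        by (simp add: A_def sum_distrib_right[symmetric])
    qed (rule N)
    then show ?thesis
    proof (rule AE_mp, intro AE_I2 impI)
      fix \<omega>
      assume "\<forall>\<^sub>F k in sequentially. \<bar>\<Sum>n<N k. a n * ((\<xi> n \<omega>)\<^sup>2 - 1 + 2 * 0 * \<xi> n \<omega>)\<bar> < A (N k) / 2"
      then have "\<forall>\<^sub>F k in sequentially. \<not> A (N k) / 2 < (\<Sum>n<N k. a n * ((\<xi> n \<omega>)\<^sup>2 - 1))"
        by (rule eventually_mono) simp
      then have "\<not> E (\<lambda>n. \<xi> n \<omega>)"
        unfolding E_def using eventually_conj eventually_False_sequentially by fastforce
      then show "(if E (\<lambda>n. \<xi> n \<omega>) then 1 else 0) = (0 :: nat)" by simp
    qed
  qed
  moreover have "AE \<omega> in M. (if E (\<lambda>n. x n + \<xi> n \<omega>) then 1 else 0) = (1 :: nat)"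
    if "x \<in> rademacher_space \<sigma>" for x
  proof -
    have x: "(x n)\<^sup>2 = (\<sigma> n)\<^sup>2" for n
      using that by (auto simp: rademacher_space_def dest!: spec[of _ n])
    \<comment> \<open>The mean of the statistic under the signal; it is the same for every choice of
      signs.\<close>
    define m where "m N = (\<Sum>n<N. a n * (\<sigma> n)\<^sup>2)" for N
    have sq_le: "(a n)\<^sup>2 \<le> a n * (\<sigma> n)\<^sup>2" for n
      using a[of n] by (simp add: power2_eq_square mult_left_mono)
    have A_le: "A N \<le> m N" for N
      unfolding A_def m_def by (rule sum_mono) (rule sq_le)
    have "AE \<omega> in M. \<forall>\<^sub>F k in sequentially. \<bar>\<Sum>n<N k. a n * ((\<xi> n \<omega>)\<^sup>2 - 1 + 2 * x n * \<xi> n \<omega>)\<bar> < m (N k) / 2"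
    proof (rule small[of "\<lambda>k. m (N k)" x])
      show "2 ^ k \<le> m (N k)" for k using N A_le order_trans by blast
      \<comment> \<open>Both \<open>(a n)\<^sup>2\<close> and
        \<open>(a n)\<^sup>2 * (\<sigma> n)\<^sup>2\<close> are at most
        \<open>a n * (\<sigma> n)\<^sup>2\<close>, which gives 2 + 4 = 6.\<close>
      have "(a n)\<^sup>2 * (2 + 4 * (\<sigma> n)\<^sup>2) \<le> 6 * (a n * (\<sigma> n)\<^sup>2)" for n
      proof -
        have "(a n)\<^sup>2 \<le> a n" using a[of n] by (simp add: power2_eq_square mult_left_le)
        then have "(a n)\<^sup>2 * (\<sigma> n)\<^sup>2 \<le> a n * (\<sigma> n)\<^sup>2" by (rule mult_right_mono) simp
        then show ?thesis using sq_le[of n] by (simp add: algebra_simps)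
      qed
      then show "(\<Sum>n<N k. (a n)\<^sup>2 * (2 + 4 * (x n)\<^sup>2)) \<le> 6 * m (N k)" for k
        unfolding m_def sum_distrib_left x by (intro sum_mono)
    qed
    then show ?thesis
    proof (rule AE_mp, intro AE_I2 impI)
      fix \<omega>
      assume "\<forall>\<^sub>F k in sequentially. \<bar>\<Sum>n<N k. a n * ((\<xi> n \<omega>)\<^sup>2 - 1 + 2 * x n * \<xi> n \<omega>)\<bar> < m (N k) / 2"
      then have "\<forall>\<^sub>F k in sequentially. A (N k) / 2 < (\<Sum>n<N k. a n * ((x n + \<xi> n \<omega>)\<^sup>2 - 1))"
      proof (rule eventually_mono)
        fix k
        \<comment> \<open>Centered part plus mean: a deviation below half the mean leaves more than
          \<open>m (N k) / 2\<close>, hence more than \<open>A (N k) / 2\<close>.\<close>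
        have eq: "(\<Sum>n<N k. a n * ((x n + \<xi> n \<omega>)\<^sup>2 - 1)) =
            (\<Sum>n<N k. a n * ((\<xi> n \<omega>)\<^sup>2 - 1 + 2 * x n * \<xi> n \<omega>)) + m (N k)"
          unfolding m_def sum.distrib[symmetric] x[symmetric]
          by (rule sum.cong) (simp_all add: power2_eq_square algebra_simps)
        assume "\<bar>\<Sum>n<N k. a n * ((\<xi> n \<omega>)\<^sup>2 - 1 + 2 * x n * \<xi> n \<omega>)\<bar> < m (N k) / 2"
        then show "A (N k) / 2 < (\<Sum>n<N k. a n * ((x n + \<xi> n \<omega>)\<^sup>2 - 1))"
          unfolding eq using A_le[of "N k"] by (simp add: abs_less_iff)
      qed
      then show "(if E (\<lambda>n. x n + \<xi> n \<omega>) then 1 else 0) = (1 :: nat)"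
        by (simp add: E_def)
    qed
  qed
  ultimately show ?thesis
    unfolding admits_detection_def by blast
qed

section \<open>Divergent series and the equivalence\<close>

lemma suminf_ennreal_eq_infinity_iff:
  fixes f :: "nat \<Rightarrow> real"
  assumes "\<And>n. 0 \<le> f n"
  shows "(\<Sum>n. ennreal (f n)) = \<infinity> \<longleftrightarrow> \<not> summable f"
proof
  assume "(\<Sum>n. ennreal (f n)) = \<infinity>"
  then show "\<not> summable f" using suminf_ennreal2[OF assms] by fastforce
next
  assume "\<not> summable f"
  then show "(\<Sum>n. ennreal (f n)) = \<infinity>" using summable_suminf_not_top[OF assms] by fastforce
qed

theorem theorem1p2:
  fixes M :: "'a measure" and \<xi> :: "nat \<Rightarrow> 'a \<Rightarrow> real" and \<sigma> :: "nat \<Rightarrow> real"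
  assumes "gaussian_noise M \<xi>"
  shows "admits_detection M \<xi> (rademacher_space \<sigma>) \<longleftrightarrow> (\<Sum>n. ennreal (\<sigma> n ^ 4)) = \<infinity>"
proof -
  have "\<not> summable (\<lambda>n. \<sigma> n ^ 4)" if detect: "admits_detection M \<xi> (rademacher_space \<sigma>)"
  proof
    assume summable: "summable (\<lambda>n. \<sigma> n ^ 4)"
    obtain T :: "(nat \<Rightarrow> real) \<Rightarrow> nat" where T [measurable]: "T \<in> borel \<rightarrow>\<^sub>M count_space {0, 1}"
      and null: "AE \<omega> in M. T (\<lambda>n. \<xi> n \<omega>) = 0"
      and alt: "\<And>x. x \<in> rademacher_space \<sigma> \<Longrightarrow> AE \<omega> in M. T (\<lambda>n. x n + \<xi> n \<omega>) = 1"
      using detect unfolding admits_detection_def by blast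
    have B: "{y. T y = 1} \<in> sets borel"
      using measurable_sets[OF T, of "{1}"] by (simp add: vimage_def)
    have "{y. T y \<noteq> 1} = - {y. T y = 1}" by auto
    then have "{y. T y \<noteq> 1} \<in> sets borel" using B by simp
    then have "AE y in gaussian_seq. T y \<noteq> 1"
      using null by (subst AE_gaussian_seq_iff[OF assms]) (auto elim: eventually_mono)
    then have "emeasure gaussian_seq {y. T y = 1} = 0"
      using AE_iff_measurable[of "{y. T y = 1}" gaussian_seq "\<lambda>y. T y \<noteq> 1"] B by simp
    \<comment> \<open>The region where the test reports a signal is null for the noise, so some
      signal fails to land in it almost surely, contradicting \<open>alt\<close>.\<close>
    from exists_signs_not_detected[OF assms summable B this]
    obtain x where x: "x \<in> rademacher_space \<sigma>" "\<not> (AE y in gaussian_seq. T (\<lambda>n. x n + y n) = 1)"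
      by auto
    from measurable_sets[OF borel_measurable_seq_add[of x] B] have "{y. T (\<lambda>n. x n + y n) = 1} \<in> sets borel"
      by (simp add: vimage_def)
    from AE_gaussian_seq_iff[OF assms this] alt[OF x(1)] x(2) show False by simp
  qed
  moreover have "(\<Sum>n. ennreal (\<sigma> n ^ 4)) = \<infinity> \<longleftrightarrow> \<not> summable (\<lambda>n. \<sigma> n ^ 4)"
    by (rule suminf_ennreal_eq_infinity_iff) (rule zero_le_even_power, simp)
  moreover note admits_detection_rademacher_space[OF assms, of \<sigma>]
  ultimately show ?thesis by argo
qed

end
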